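(* Fix an integer $q\ge2$ and $\lambda>0$. For each $n$, let $(N_{n,i,j}:1\le i\le m_n,\ 1\le j\le q)$ be independent random variables, $N_{n,i,j}$ having the Poisson distribution with mean $\alpha_{n,i,j}$. Put $$\beta_{n,i}:=\prod_{j=1}^q\alpha_{n,i,j},\qquad X_n:=\sum_{i=1}^{m_n}\prod_{j=1}^qN_{n,i,j},\qquad \delta_n:=\max_{1\le i\le m_n,\ 1\le j\le q}\alpha_{n,i,j}.$$ If $\delta_n\to0$ and $\sum_{i=1}^{m_n}\beta_{n,i}\to\lambda$, then $X_n$ converges to $\mathrm{Poisson}(\lambda)$ in total variation, and its first four moments converge to those of the limit. Moreover, there exists a constant $C_{q,\lambda}$ depending only on $q$ and $\lambda$ such that $$d_{\mathrm{TV}}(X_n,P_\lambda)\le C_{q,\lambda}\left(\Big|\sum_{i=1}^{m_n}\beta_{n,i}-\lambda\Big|+\sqrt{\delta_n}\right)$$ for all sufficiently large $n$.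
   Context: $P_\lambda$ is a Poisson random variable with mean $\lambda$. For random variables with values in $\mathbb N_0=\{0,1,2,\dots\}$, $d_{\mathrm{TV}}(X,Y)=\sup_{A\subseteq\mathbb N_0}|\mathbb P(X\in A)-\mathbb P(Y\in A)|$. Here $m_n\in\mathbb N=\{1,2,\dots\}$. *)

theory Defs
  imports "HOL-Probability.Probability"
begin

definition tv_dist :: "nat measure \<Rightarrow> nat measure \<Rightarrow> real" where
  "tv_dist \<mu> \<nu> = (SUP A. \<bar>measure \<mu> A - measure \<nu> A\<bar>)"

definition law :: "'a measure \<Rightarrow> ('a \<Rightarrow> nat) \<Rightarrow> nat measure" where
  "law M X = distr M (count_space UNIV) X"

text \<open>The library's \<^const>\<open>poisson_pmf\<close> is only specified for a positive rate; the Poisson law with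
  mean \<open>0\<close> is the point mass at \<open>0\<close>.\<close>

definition poisson_law :: "real \<Rightarrow> nat pmf" where
  "poisson_law a = (if a = 0 then return_pmf 0 else poisson_pmf a)"

text \<open>The rows may live on different probability spaces, and nothing is assumed about the joint
  behaviour of different rows.\<close>

definition poisson_array ::
    "nat \<Rightarrow> (nat \<Rightarrow> nat) \<Rightarrow> (nat \<Rightarrow> nat \<Rightarrow> nat \<Rightarrow> real)
      \<Rightarrow> (nat \<Rightarrow> 'a measure) \<Rightarrow> (nat \<Rightarrow> nat \<Rightarrow> nat \<Rightarrow> 'a \<Rightarrow> nat) \<Rightarrow> bool" where
  "poisson_array q m \<alpha> M N \<longleftrightarrow>
     (\<forall>n. 1 \<le> m n \<and> prob_space (M n) \<and>
        prob_space.indep_vars (M n) (\<lambda>_. count_space UNIV) (\<lambda>(i, j). N n i j) ({1..m n} \<times> {1..q}) \<and>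
        (\<forall>i\<in>{1..m n}. \<forall>j\<in>{1..q}. 0 \<le> \<alpha> n i j \<and>
           law (M n) (N n i j) = measure_pmf (poisson_law (\<alpha> n i j))))"

definition sum_of_products ::
    "nat \<Rightarrow> (nat \<Rightarrow> nat) \<Rightarrow> (nat \<Rightarrow> nat \<Rightarrow> nat \<Rightarrow> 'a \<Rightarrow> nat) \<Rightarrow> nat \<Rightarrow> 'a \<Rightarrow> nat" where
  "sum_of_products q m N n = (\<lambda>\<omega>. \<Sum>i=1..m n. \<Prod>j=1..q. N n i j \<omega>)"

definition sum_beta :: "nat \<Rightarrow> (nat \<Rightarrow> nat) \<Rightarrow> (nat \<Rightarrow> nat \<Rightarrow> nat \<Rightarrow> real) \<Rightarrow> nat \<Rightarrow> real" where
  "sum_beta q m \<alpha> n = (\<Sum>i=1..m n. \<Prod>j=1..q. \<alpha> n i j)"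

definition max_mean :: "nat \<Rightarrow> (nat \<Rightarrow> nat) \<Rightarrow> (nat \<Rightarrow> nat \<Rightarrow> nat \<Rightarrow> real) \<Rightarrow> nat \<Rightarrow> real" where
  "max_mean q m \<alpha> n = Max ((\<lambda>(i, j). \<alpha> n i j) ` ({1..m n} \<times> {1..q}))"

text \<open>\<open>C\<close> is a valid constant in the rate bound, simultaneously for all admissible arrays on sample
  spaces with elements of type \<open>'a\<close>.\<close>

definition rate_constant :: "'a itself \<Rightarrow> nat \<Rightarrow> real \<Rightarrow> real \<Rightarrow> bool" where
  "rate_constant (T :: 'a itself) q lam C \<longleftrightarrow>
     (\<forall>m \<alpha> (M :: nat \<Rightarrow> 'a measure) N.
        poisson_array q m \<alpha> M N \<and> max_mean q m \<alpha> \<longlonglongrightarrow> 0 \<and> sum_beta q m \<alpha> \<longlonglongrightarrow> lam \<longrightarrow>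
        (\<forall>\<^sub>F n in sequentially.
           tv_dist (law (M n) (sum_of_products q m N n)) (measure_pmf (poisson_pmf lam))
             \<le> C * (\<bar>sum_beta q m \<alpha> n - lam\<bar> + sqrt (max_mean q m \<alpha> n))))"

text \<open>A constant depending only on \<open>q\<close> and \<open>lam\<close> must not depend on the sample space, not even on the
  type of its elements. Since a type cannot be quantified over inside a formula, an existential
  statement \<open>\<exists>C. rate_constant TYPE('a) q lam C\<close> would allow \<open>C\<close> to vary with \<open>'a\<close>. Hence the theorem
  asserts existence for the concrete sample type \<^typ>\<open>nat \<Rightarrow> nat \<Rightarrow> nat\<close>, and every
  constant valid there is then shown to be valid for every type \<open>'a\<close>.\<close>

end

theory Submission
  imports Defs
begin

text \<open>
  Every row is close to a row of Poisson variables, and closeness in total variation adds up over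
  independent summands. Let \<open>Y\<close> be a product of \<open>q\<close> independent Poisson variables with means
  \<open>\<alpha>\<^sub>1, \<dots>, \<alpha>\<^sub>q \<le> \<delta> \<le> 1\<close> and put \<open>\<beta> = \<alpha>\<^sub>1 \<cdots> \<alpha>\<^sub>q\<close>. Then \<open>P (Y \<ge> 1) \<le> \<beta>\<close> and
  \<open>P (Y = 1) \<ge> \<beta> exp (- q \<delta>) \<ge> \<beta> - q \<delta> \<beta>\<close>, and the Poisson law with mean \<open>\<beta>\<close> satisfies the same two
  inequalities because \<open>\<beta> \<le> \<delta>\<close>. Two laws on the natural numbers with this property differ by at most
  \<open>q \<delta> \<beta>\<close> (\<open>tv_dist_poisson_product_pmf_poisson_law\<close>). Summing over \<open>i\<close>, and using that Poisson laws
  form a convolution semigroup, \<open>X\<^sub>n\<close> is within \<open>q \<delta>\<^sub>n s\<^sub>n\<close> of the Poisson law with mean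
  \<open>s\<^sub>n = \<Sum>\<^sub>i \<beta>\<^sub>n\<^sub>,\<^sub>i\<close>, which in turn is within \<open>\<bar>s\<^sub>n - \<lambda>\<bar>\<close> of the Poisson law with mean \<open>\<lambda>\<close>
  (\<open>tv_dist_sum_of_products_le\<close>). Since \<open>s\<^sub>n \<le> \<lambda> + 1\<close> and \<open>\<delta>\<^sub>n \<le> sqrt \<delta>\<^sub>n\<close> eventually, the
  constant \<open>1 + q (\<lambda> + 1)\<close> works in the rate bound.

  Products of several Poisson variables have no exponential moments, but their moments of every
  fixed order \<open>k \<ge> 1\<close> are at most a fixed multiple of \<open>\<beta>\<close>. The functional \<open>E (1 + X)^k\<close> is submultiplicative under
  convolution, so for \<open>X\<^sub>n\<close> it is bounded by a product of factors \<open>1 + c \<beta>\<^sub>n\<^sub>,\<^sub>i\<close>, hence by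
  \<open>exp (c s\<^sub>n)\<close>, which stays bounded. A bounded moment of order \<open>k + 1\<close> makes the \<open>k\<close>-th powers
  uniformly integrable, and together with the convergence of the point probabilities this gives
  convergence of the \<open>k\<close>-th moments, for every \<open>k\<close> (\<open>moments_converge\<close>).

  The bound holds on every sample space because the law of \<open>X\<^sub>n\<close> depends only on the means. The same
  fact transfers a rate constant between types of sample points: every array has a copy with the same
  laws on the coordinate functions of a discrete product measure (\<open>poisson_array_grid_pmf\<close>).
\<close>

section \<open>Total variation distance and convolution\<close>

lemma tv_dist_pmf_upper:
  "\<bar>measure (measure_pmf p) A - measure (measure_pmf r) A\<bar> \<le> tv_dist (measure_pmf p) (measure_pmf r)"
proof -
  have "\<bar>measure (measure_pmf p) A - measure (measure_pmf r) A\<bar> \<le> 1" for A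
    using measure_pmf.prob_le_1[of p A] measure_pmf.prob_le_1[of r A]
      measure_nonneg[of "measure_pmf p" A] measure_nonneg[of "measure_pmf r" A] by linarith
  then have "bdd_above (range (\<lambda>A. \<bar>measure (measure_pmf p) A - measure (measure_pmf r) A\<bar>))"
    by (auto intro!: bdd_aboveI2)
  then show ?thesis unfolding tv_dist_def by (rule cSUP_upper2) auto
qed

lemma tv_dist_least:
  "(\<And>A. \<bar>measure \<mu> A - measure \<nu> A\<bar> \<le> c) \<Longrightarrow> tv_dist \<mu> \<nu> \<le> c"
  unfolding tv_dist_def by (rule cSUP_least) auto

lemma tv_dist_pmf_nonneg: "0 \<le> tv_dist (measure_pmf p) (measure_pmf r)"
  using tv_dist_pmf_upper[of p "{}" r] by simp

lemma tv_dist_pmf_triangle: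
  "tv_dist (measure_pmf p) (measure_pmf s)
    \<le> tv_dist (measure_pmf p) (measure_pmf r) + tv_dist (measure_pmf r) (measure_pmf s)"
proof (rule tv_dist_least)
  fix A
  show "\<bar>measure (measure_pmf p) A - measure (measure_pmf s) A\<bar>
    \<le> tv_dist (measure_pmf p) (measure_pmf r) + tv_dist (measure_pmf r) (measure_pmf s)"
    using tv_dist_pmf_upper[of p A r] tv_dist_pmf_upper[of r A s] by linarith
qed

lemma tv_dist_commute: "tv_dist \<mu> \<nu> = tv_dist \<nu> \<mu>"
  by (simp add: tv_dist_def abs_minus_commute)

lemma tv_dist_map_pmf_le:
  fixes p r :: "nat pmf"
  shows "tv_dist (map_pmf f p) (map_pmf f r) \<le> tv_dist p r"
  by (rule tv_dist_least) (simp add: tv_dist_pmf_upper)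

lemma measure_bind_pmf:
  "measure (measure_pmf (bind_pmf p k)) A = (\<integral>x. measure (measure_pmf (k x)) A \<partial>measure_pmf p)"
proof -
  have "ennreal (measure (bind_pmf p k) A) = (\<integral>\<^sup>+x. ennreal (measure (k x) A) \<partial>p)"
    by (simp flip: measure_pmf.emeasure_eq_measure)
  also have "\<dots> = ennreal (\<integral>x. measure (k x) A \<partial>p)"
    by (intro nn_integral_eq_integral measure_pmf.integrable_const_bound[where B = 1]) auto
  finally show ?thesis by (simp add: integral_nonneg_AE)
qed

text \<open>Mixing commutes with evaluation at an event, so a mixture cannot be further apart than its
  components are.\<close>

lemma tv_dist_bind_pmf_le:
  assumes "\<And>x. tv_dist (measure_pmf (k x)) (measure_pmf (k' x)) \<le> c"
  shows "tv_dist (measure_pmf (bind_pmf p k)) (measure_pmf (bind_pmf p k')) \<le> c"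
proof (rule tv_dist_least)
  fix A
  have int: "integrable (measure_pmf p) (\<lambda>x. measure (measure_pmf (k x)) A)" for k :: "'a \<Rightarrow> nat pmf"
    by (intro measure_pmf.integrable_const_bound[where B = 1]) auto
  have d: "\<bar>measure (k x) A - measure (k' x) A\<bar> \<le> c" for x
    using tv_dist_pmf_upper[of "k x" A "k' x"] assms[of x] by linarith
  have "\<bar>measure (bind_pmf p k) A - measure (bind_pmf p k') A\<bar>
     = \<bar>\<integral>x. measure (k x) A - measure (k' x) A \<partial>p\<bar>"
    by (simp add: measure_bind_pmf int)
  also have "\<dots> \<le> (\<integral>x. \<bar>measure (k x) A - measure (k' x) A\<bar> \<partial>p)"
    by (rule integral_abs_bound)
  also have "\<dots> \<le> (\<integral>x. c \<partial>p)"
    using int[of k] int[of k'] by (intro integral_mono d) auto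
  finally show "\<bar>measure (bind_pmf p k) A - measure (bind_pmf p k') A\<bar> \<le> c" by simp
qed

definition add_pmf :: "nat pmf \<Rightarrow> nat pmf \<Rightarrow> nat pmf" where
  "add_pmf p r = map_pmf (\<lambda>(x, y). x + y) (pair_pmf p r)"

lemma add_pmf_conv_bind: "add_pmf p r = bind_pmf p (\<lambda>x. map_pmf (\<lambda>y. x + y) r)"
  by (simp add: add_pmf_def pair_pmf_def map_pmf_def bind_assoc_pmf bind_return_pmf)

lemma add_pmf_commute: "add_pmf p r = add_pmf r p"
  unfolding add_pmf_def
  by (subst pair_commute_pmf) (simp add: pmf.map_comp o_def case_prod_unfold add.commute)

lemma add_pmf_0_right: "add_pmf p (return_pmf 0) = p"
  by (simp add: add_pmf_conv_bind bind_return_pmf')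

text \<open>Exchange one summand at a time: conditionally on the other summand, the exchange acts inside a
  translate of a single law.\<close>

lemma tv_dist_add_pmf_le:
  "tv_dist (add_pmf p r) (add_pmf p' r') \<le> tv_dist p p' + tv_dist r r'"
proof -
  have right: "tv_dist (add_pmf p r) (add_pmf p r') \<le> tv_dist r r'" for p r r'
    unfolding add_pmf_conv_bind by (intro tv_dist_bind_pmf_le tv_dist_map_pmf_le)
  have "tv_dist (add_pmf p r') (add_pmf p' r') \<le> tv_dist p p'"
    using right[of r' p p'] by (simp add: add_pmf_commute)
  with right[of p r r'] tv_dist_pmf_triangle[of "add_pmf p r" "add_pmf p' r'" "add_pmf p r'"]
  show ?thesis by linarith
qed

definition sum_pmf :: "'i set \<Rightarrow> ('i \<Rightarrow> nat pmf) \<Rightarrow> nat pmf" where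
  "sum_pmf I p = map_pmf (\<lambda>f. \<Sum>i\<in>I. f i) (Pi_pmf I 0 p)"

lemma sum_pmf_empty: "sum_pmf {} p = return_pmf 0"
  by (simp add: sum_pmf_def)

lemma sum_pmf_insert:
  assumes "finite I" "i \<notin> I"
  shows "sum_pmf (insert i I) p = add_pmf (p i) (sum_pmf I p)"
proof -
  have "sum_pmf (insert i I) p
    = map_pmf (\<lambda>(y, f). y + (\<Sum>j\<in>I. f j)) (pair_pmf (p i) (Pi_pmf I 0 p))"
    unfolding sum_pmf_def using assms
    by (auto simp: Pi_pmf_insert pmf.map_comp o_def case_prod_unfold intro!: map_pmf_cong sum.cong)
  also have "\<dots> = add_pmf (p i) (sum_pmf I p)"
    by (simp add: add_pmf_def sum_pmf_def pair_map_pmf2 pmf.map_comp o_def case_prod_unfold)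
  finally show ?thesis .
qed

lemma tv_dist_sum_pmf_le:
  assumes "finite I"
  shows "tv_dist (sum_pmf I p) (sum_pmf I r) \<le> (\<Sum>i\<in>I. tv_dist (p i) (r i))"
  using assms
proof induction
  case empty
  show ?case by (auto simp: sum_pmf_empty intro: tv_dist_least)
next
  case (insert i I)
  then show ?case
    using tv_dist_add_pmf_le[of "p i" "sum_pmf I p" "r i" "sum_pmf I r"]
    by (simp add: sum_pmf_insert)
qed

section \<open>Poisson approximation of a product of Poisson variables\<close>

lemma pmf_poisson_law: "0 \<le> a \<Longrightarrow> pmf (poisson_law a) k = a ^ k / fact k * exp (- a)"
  by (cases k) (auto simp: poisson_law_def)

text \<open>The binomial theorem, read off from the point probabilities.\<close>

lemma poisson_law_add:
  assumes "0 \<le> a" "0 \<le> b"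
  shows "add_pmf (poisson_law a) (poisson_law b) = poisson_law (a + b)"
proof (rule pmf_eqI)
  fix n
  have "pmf (add_pmf (poisson_law a) (poisson_law b)) n
     = measure (pair_pmf (poisson_law a) (poisson_law b)) ((\<lambda>(x, y). x + y) -` {n})"
    by (simp add: add_pmf_def pmf_map)
  also have "(\<lambda>(x, y). x + y) -` {n} = (\<lambda>k. (k, n - k)) ` {..n}"
    by (auto simp: image_iff)
  also have "measure (pair_pmf (poisson_law a) (poisson_law b)) \<dots>
      = (\<Sum>k\<le>n. pmf (poisson_law a) k * pmf (poisson_law b) (n - k))"
    by (subst measure_measure_pmf_finite) (auto simp: sum.reindex inj_on_def pmf_pair)
  also have "\<dots> = (\<Sum>k\<le>n. of_nat (n choose k) * a ^ k * b ^ (n - k)) / fact n * exp (- (a + b))"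
    unfolding sum_divide_distrib sum_distrib_right
  proof (intro sum.cong refl)
    fix k assume "k \<in> {..n}"
    then have "k \<le> n" by simp
    have "pmf (poisson_law a) k * pmf (poisson_law b) (n - k)
        = a ^ k * b ^ (n - k) * (1 / (fact k * fact (n - k))) * exp (- a + - b)"
      using assms unfolding exp_add by (simp add: pmf_poisson_law)
    also have "1 / (fact k * fact (n - k)) = real (n choose k) / fact n"
      using \<open>k \<le> n\<close> by (simp add: binomial_fact)
    finally show "pmf (poisson_law a) k * pmf (poisson_law b) (n - k)
        = of_nat (n choose k) * a ^ k * b ^ (n - k) / fact n * exp (- (a + b))"
      by (simp add: mult_ac)
  qed
  also have "\<dots> = pmf (poisson_law (a + b)) n"
    using assms by (simp only: pmf_poisson_law add_nonneg_nonneg binomial_ring[of a b n] atMost_atLeast0)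
  finally show "pmf (add_pmf (poisson_law a) (poisson_law b)) n = pmf (poisson_law (a + b)) n" .
qed

lemma sum_pmf_poisson_law:
  assumes "finite I" "\<And>i. i \<in> I \<Longrightarrow> 0 \<le> a i"
  shows "sum_pmf I (\<lambda>i. poisson_law (a i)) = poisson_law (\<Sum>i\<in>I. a i)"
  using assms
proof induction
  case empty
  show ?case by (simp add: sum_pmf_empty poisson_law_def)
next
  case (insert i I)
  then show ?case by (simp add: sum_pmf_insert poisson_law_add sum_nonneg)
qed

lemma prob_poisson_law_pos:
  assumes "0 \<le> a"
  shows "measure (poisson_law a) {1..} \<le> a"
proof -
  have "measure (poisson_law a) (UNIV - {0}) = 1 - pmf (poisson_law a) 0"
    using measure_pmf.prob_compl[of "{0}" "poisson_law a"] by (simp add: measure_pmf_single)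
  also have "UNIV - {0} = {1::nat..}" by auto
  also have "1 - pmf (poisson_law a) 0 \<le> a"
    using assms exp_ge_add_one_self[of "- a"] by (simp add: pmf_poisson_law)
  finally show ?thesis .
qed

text \<open>The Poisson variable with the larger mean is the one with the smaller mean plus an independent
  Poisson variable, which is nonzero with probability at most the difference of the means.\<close>

lemma tv_dist_poisson_law:
  assumes "0 \<le> a" "0 \<le> b"
  shows "tv_dist (poisson_law a) (poisson_law b) \<le> \<bar>a - b\<bar>"
proof -
  have *: "tv_dist (poisson_law a) (poisson_law b) \<le> b - a" if "0 \<le> a" "a \<le> b" for a b
  proof -
    have "tv_dist (return_pmf 0) (poisson_law (b - a)) \<le> b - a"
    proof (rule tv_dist_least)
      fix A :: "nat set"
      have le: "measure (poisson_law (b - a)) B \<le> b - a" if "0 \<notin> B" for B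
      proof -
        have "measure (poisson_law (b - a)) B \<le> measure (poisson_law (b - a)) {1..}"
        proof (rule measure_pmf.finite_measure_mono)
          show "B \<subseteq> {1..}"
          proof
            fix x assume "x \<in> B"
            with that show "x \<in> {1..}" by (cases x) auto
          qed
        qed simp
        with prob_poisson_law_pos[of "b - a"] \<open>a \<le> b\<close> show ?thesis by simp
      qed
      show "\<bar>measure (return_pmf 0) A - measure (poisson_law (b - a)) A\<bar> \<le> b - a"
      proof (cases "0 \<in> A")
        case True
        then show ?thesis
          using le[of "UNIV - A"] measure_pmf.prob_compl[of A "poisson_law (b - a)"]
          by (simp add: measure_return_pmf)
      next
        case False
        then show ?thesis using le[of A] by (simp add: measure_return_pmf)
      qed
    qed
    moreover have "tv_dist (poisson_law a) (poisson_law b)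
       = tv_dist (add_pmf (poisson_law a) (return_pmf 0)) (add_pmf (poisson_law a) (poisson_law (b - a)))"
      using that by (simp add: add_pmf_0_right poisson_law_add)
    moreover have "\<dots> \<le> tv_dist (poisson_law a) (poisson_law a) + tv_dist (return_pmf 0) (poisson_law (b - a))"
      by (rule tv_dist_add_pmf_le)
    moreover have "tv_dist (poisson_law a) (poisson_law a) \<le> 0"
      by (auto intro: tv_dist_least)
    ultimately show ?thesis by linarith
  qed
  show ?thesis
    using *[of a b] *[of b a] assms tv_dist_commute[of "poisson_law a" "poisson_law b"] by linarith
qed

text \<open>The mass of \<open>{2..}\<close> is at most \<open>b - (b - e) = e\<close>. Hence an event that does not contain \<open>0\<close> has
  its probability in \<open>[b - e, b]\<close> if it contains \<open>1\<close> and in \<open>[0, e]\<close> otherwise; the remaining events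
  are the complements of these.\<close>

lemma tv_dist_le_of_rare:
  fixes p r :: "nat pmf"
  assumes "measure p {1..} \<le> b" "b - e \<le> pmf p 1"
    and "measure r {1..} \<le> b" "b - e \<le> pmf r 1"
  shows "tv_dist p r \<le> e"
proof (rule tv_dist_least)
  fix A :: "nat set"
  have split: "measure s A = of_bool (0 \<in> A) * pmf s 0 + of_bool (1 \<in> A) * pmf s 1 + measure s (A \<inter> {2..})"
    for s :: "nat pmf" and A
  proof -
    have "A = (A \<inter> {0}) \<union> (A \<inter> {1}) \<union> (A \<inter> {2..})" by force
    then have "measure s A = measure s ((A \<inter> {0}) \<union> (A \<inter> {1}) \<union> (A \<inter> {2..}))" by simp
    also have "\<dots> = measure s (A \<inter> {0}) + measure s (A \<inter> {1}) + measure s (A \<inter> {2..})"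
      by (subst measure_pmf.finite_measure_Union, simp, simp, force,
        subst measure_pmf.finite_measure_Union) auto
    finally show ?thesis by (auto simp: measure_pmf_single)
  qed
  have tot: "1 = pmf s 0 + pmf s 1 + measure s {2..}" for s :: "nat pmf"
    using split[of s UNIV] by simp
  have pos: "measure s {1..} = pmf s 1 + measure s {2..}" for s :: "nat pmf"
    using split[of s "{1..}"] by (simp add: Int_absorb1)
  have le: "measure s (A \<inter> {2..}) \<le> measure s {2..}" for s :: "nat pmf"
    by (intro measure_pmf.finite_measure_mono) auto
  have nn: "0 \<le> measure s (A \<inter> {2..})" for s :: "nat pmf" by simp
  have small: "measure p {2..} \<le> e" "measure r {2..} \<le> e"
    using assms unfolding pos by linarith+
  show "\<bar>measure p A - measure r A\<bar> \<le> e"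
    using assms[unfolded pos] small tot[of p] tot[of r] le[of p] le[of r] nn[of p] nn[of r]
    unfolding split[of p A] split[of r A]
    by (cases "0 \<in> A"; cases "1 \<in> A"; simp only: of_bool_eq mult_1 mult_zero_left; linarith)
qed

definition poisson_product_pmf :: "'i set \<Rightarrow> ('i \<Rightarrow> real) \<Rightarrow> nat pmf" where
  "poisson_product_pmf J a = map_pmf (\<lambda>f. \<Prod>j\<in>J. f j) (Pi_pmf J 0 (\<lambda>j. poisson_law (a j)))"

text \<open>A product of natural numbers is nonzero, or equal to one, exactly if all its factors are; this
  reduces both of the following probabilities to the factors.\<close>

lemma prob_poisson_product_pmf_pos:
  assumes "finite J" "\<And>j. j \<in> J \<Longrightarrow> 0 \<le> a j"
  shows "measure (poisson_product_pmf J a) {1..} \<le> (\<Prod>j\<in>J. a j)"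
proof -
  have "measure (poisson_product_pmf J a) {1..}
     = measure (Pi_pmf J 0 (\<lambda>j. poisson_law (a j))) (Pi J (\<lambda>_. {1..}))"
  proof -
    have "(\<lambda>f. \<Prod>j\<in>J. f j) -` {1..} = Pi J (\<lambda>_. {1::nat..})"
      using assms(1) prod_pos_nat_iff[OF assms(1)] by (auto simp: Suc_le_eq Pi_iff)
    then show ?thesis by (simp only: poisson_product_pmf_def measure_map_pmf)
  qed
  also have "\<dots> = (\<Prod>j\<in>J. measure (poisson_law (a j)) {1..})"
    by (rule measure_Pi_pmf_Pi) fact
  also have "\<dots> \<le> (\<Prod>j\<in>J. a j)"
    using assms by (intro prod_mono) (auto intro: prob_poisson_law_pos[simplified])
  finally show ?thesis .
qed

lemma pmf_poisson_product_pmf_1: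
  assumes "finite J" "\<And>j. j \<in> J \<Longrightarrow> 0 \<le> a j"
  shows "pmf (poisson_product_pmf J a) 1 = (\<Prod>j\<in>J. a j) * exp (- (\<Sum>j\<in>J. a j))"
proof -
  have "pmf (poisson_product_pmf J a) 1
     = measure (Pi_pmf J 0 (\<lambda>j. poisson_law (a j))) (Pi J (\<lambda>_. {1}))"
  proof -
    have "(\<lambda>f. \<Prod>j\<in>J. f j) -` {1} = Pi J (\<lambda>_. {1::nat})"
      using prod_eq_1_iff[OF assms(1)] by (auto simp: Pi_iff)
    then show ?thesis by (simp only: poisson_product_pmf_def pmf_map)
  qed
  also have "\<dots> = (\<Prod>j\<in>J. pmf (poisson_law (a j)) 1)"
    using assms(1) by (subst measure_Pi_pmf_Pi) (auto simp: measure_pmf_single)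
  also have "\<dots> = (\<Prod>j\<in>J. a j * exp (- a j))"
    using assms by (intro prod.cong) (auto simp: pmf_poisson_law)
  also have "\<dots> = (\<Prod>j\<in>J. a j) * exp (- (\<Sum>j\<in>J. a j))"
    using assms(1) by (simp add: prod.distrib exp_sum sum_negf[symmetric])
  finally show ?thesis .
qed

text \<open>The product and the Poisson variable with the same mean are both rare in the sense of
  \<open>tv_dist_le_of_rare\<close>, with \<open>b\<close> the common mean. The factor \<open>b\<close> in the error keeps
  the sum of the errors over a row small.\<close>

lemma tv_dist_poisson_product_pmf_poisson_law:
  assumes "finite J" "J \<noteq> {}" "\<And>j. j \<in> J \<Longrightarrow> 0 \<le> a j \<and> a j \<le> d" "d \<le> 1"
  shows "tv_dist (poisson_product_pmf J a) (poisson_law (\<Prod>j\<in>J. a j)) \<le> real (card J) * d * (\<Prod>j\<in>J. a j)"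
proof -
  define b where "b = (\<Prod>j\<in>J. a j)"
  have b0: "0 \<le> b" unfolding b_def using assms by (auto intro: prod_nonneg)
  obtain j0 where j0: "j0 \<in> J" using assms by auto
  have "b = a j0 * (\<Prod>j\<in>J - {j0}. a j)"
    unfolding b_def using assms j0 by (simp add: prod.remove)
  also have "\<dots> \<le> a j0 * 1"
    using assms(3)[OF j0] order.trans[OF _ assms(4)] assms(3)
    by (intro mult_left_mono prod_le_1) auto
  finally have bd: "b \<le> d" using assms(3)[OF j0] by simp
  have d0: "0 \<le> d" using b0 bd by simp
  have card: "1 \<le> real (card J)"
    using assms by (simp add: Suc_le_eq card_gt_0_iff)
  have exp_bound: "b - real (card J) * d * b \<le> b * exp (- s)" if "s \<le> real (card J) * d" for s
  proof -
    have "b * (1 - real (card J) * d) \<le> b * exp (- s)"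
      using that exp_ge_add_one_self[of "- s"] by (intro mult_left_mono b0) linarith
    then show ?thesis by (simp add: algebra_simps)
  qed
  have "(\<Sum>j\<in>J. a j) \<le> real (card J) * d"
    using assms by (intro sum_bounded_above) auto
  from exp_bound[OF this] have 1: "b - real (card J) * d * b \<le> pmf (poisson_product_pmf J a) 1"
    using assms by (subst pmf_poisson_product_pmf_1) (auto simp: b_def)
  have "b \<le> real (card J) * d"
    using bd mult_right_mono[OF card d0] by simp
  from exp_bound[OF this] have 2: "b - real (card J) * d * b \<le> pmf (poisson_law b) 1"
    using b0 by (simp add: pmf_poisson_law)
  have "measure (poisson_product_pmf J a) {1..} \<le> b"
    unfolding b_def using assms by (intro prob_poisson_product_pmf_pos) auto
  from tv_dist_le_of_rare[OF this 1 prob_poisson_law_pos[OF b0] 2] show ?thesis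
    by (simp only: b_def)
qed

section \<open>Moments\<close>

lemma power_le_fact_mult_exp:
  assumes "0 \<le> (x::real)"
  shows "x ^ k \<le> fact k * exp x"
proof -
  have "(\<Sum>n\<in>{k}. x ^ n /\<^sub>R fact n) \<le> (\<Sum>n. x ^ n /\<^sub>R fact n)"
    using assms by (intro sum_le_suminf summable_exp_generic) auto
  then have "x ^ k / fact k \<le> exp x"
    by (simp add: exp_def divide_inverse mult.commute)
  then show ?thesis by (simp add: field_simps)
qed

text \<open>For \<open>k \<ge> 1\<close> the term at \<open>0\<close> vanishes, so one factor \<open>a\<close> can be taken out of the series of the
  \<open>k\<close>-th moment; the remaining series converges uniformly for \<open>a \<le> c\<close>.\<close>

lemma poisson_law_moment_le:
  assumes "1 \<le> k" "0 < c"
  obtains D where "0 \<le> D"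
    "\<And>a. 0 \<le> a \<Longrightarrow> a \<le> c \<Longrightarrow>
      (\<integral>\<^sup>+x. ennreal (real x ^ k) \<partial>measure_pmf (poisson_law a)) \<le> ennreal (D * a)"
proof
  \<comment> \<open>At \<open>x = 0\<close>, where the exponent is truncated, the factor \<open>real x ^ k\<close> vanishes.\<close>
  let ?t = "\<lambda>x::nat. real x ^ k * c ^ (x - 1) / fact x"
  have summable: "summable ?t"
  proof (rule summable_comparison_test)
    have "norm (?t x) \<le> fact k / c * ((exp 1 * c) ^ x /\<^sub>R fact x)" if "1 \<le> x" for x
    proof -
      have "real x ^ k * c ^ (x - 1) \<le> (fact k * exp (real x)) * c ^ (x - 1)"
        using assms by (intro mult_right_mono power_le_fact_mult_exp) auto
      also have "\<dots> = fact k / c * (exp 1 * c) ^ x"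
      proof -
        have "exp (real x) = exp 1 ^ x" using exp_of_nat_mult[of x "1::real"] by simp
        moreover have "c ^ x = c * c ^ (x - 1)" using that by (cases x) auto
        ultimately show ?thesis using assms by (simp only: power_mult_distrib) simp
      qed
      finally show ?thesis
        using assms by (simp add: field_simps)
    qed
    then show "\<exists>N. \<forall>x\<ge>N. norm (?t x) \<le> fact k / c * ((exp 1 * c) ^ x /\<^sub>R fact x)" by blast
    show "summable (\<lambda>x. fact k / c * ((exp 1 * c) ^ x /\<^sub>R fact x))"
      by (intro summable_mult summable_exp_generic)
  qed
  show "0 \<le> suminf ?t" using assms by (intro suminf_nonneg summable) auto
  fix a :: real assume a: "0 \<le> a" "a \<le> c"
  have "(\<integral>\<^sup>+x. ennreal (real x ^ k) \<partial>measure_pmf (poisson_law a))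
      = (\<Sum>x. ennreal (pmf (poisson_law a) x) * ennreal (real x ^ k))"
    by (simp add: nn_integral_measure_pmf nn_integral_count_space_nat)
  also have "\<dots> \<le> (\<Sum>x. ennreal (?t x * a))"
  proof (intro suminf_le)
    fix x
    have "pmf (poisson_law a) x * real x ^ k \<le> ?t x * a"
    proof (cases x)
      case 0
      then show ?thesis using assms by (simp add: power_0_left)
    next
      case (Suc y)
      have "a ^ y * exp (- a) \<le> c ^ y * 1"
        using a by (intro mult_mono power_mono) auto
      then have "(a ^ y * exp (- a)) * (a * real x ^ k / fact x) \<le> (c ^ y * 1) * (a * real x ^ k / fact x)"
        using a by (intro mult_right_mono) auto
      then show ?thesis
        using a Suc by (simp add: pmf_poisson_law mult_ac)
    qed
    then show "ennreal (pmf (poisson_law a) x) * ennreal (real x ^ k) \<le> ennreal (?t x * a)"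
      by (simp add: ennreal_mult'[symmetric] ennreal_leI)
  qed auto
  also have "\<dots> = ennreal (\<Sum>x. ?t x * a)"
    using assms a by (intro suminf_ennreal2 summable_mult2 summable) auto
  also have "(\<Sum>x. ?t x * a) = suminf ?t * a"
    by (rule suminf_mult2[OF summable, symmetric])
  finally show "(\<integral>\<^sup>+x. ennreal (real x ^ k) \<partial>measure_pmf (poisson_law a)) \<le> ennreal (suminf ?t * a)" .
qed

lemma poisson_product_pmf_moment_le:
  assumes "finite J" "0 \<le> D"
    and "\<And>j. j \<in> J \<Longrightarrow> 0 \<le> a j"
    and "\<And>j. j \<in> J \<Longrightarrow> (\<integral>\<^sup>+x. ennreal (real x ^ k) \<partial>measure_pmf (poisson_law (a j))) \<le> ennreal (D * a j)"
  shows "(\<integral>\<^sup>+x. ennreal (real x ^ k) \<partial>measure_pmf (poisson_product_pmf J a)) \<le> ennreal (D ^ card J * (\<Prod>j\<in>J. a j))"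
proof -
  have "(\<integral>\<^sup>+x. ennreal (real x ^ k) \<partial>measure_pmf (poisson_product_pmf J a))
      = (\<integral>\<^sup>+f. (\<Prod>j\<in>J. ennreal (real (f j) ^ k)) \<partial>measure_pmf (Pi_pmf J 0 (\<lambda>j. poisson_law (a j))))"
    by (simp add: poisson_product_pmf_def prod_ennreal prod_power_distrib)
  also have "\<dots> = (\<Prod>j\<in>J. \<integral>\<^sup>+x. ennreal (real x ^ k) \<partial>measure_pmf (poisson_law (a j)))"
    using assms(1) by (rule nn_integral_prod_Pi_pmf)
  also have "\<dots> \<le> (\<Prod>j\<in>J. ennreal (D * a j))"
    by (intro prod_mono_ennreal assms)
  also have "\<dots> = ennreal (D ^ card J * (\<Prod>j\<in>J. a j))"
    using assms by (simp add: prod_ennreal prod.distrib)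
  finally show ?thesis .
qed

text \<open>The shift by \<open>1\<close> turns a small \<open>k\<close>-th moment into a factor close to \<open>1\<close>, which is what survives
  multiplication over a long row.\<close>

lemma shifted_moment_le:
  assumes "1 \<le> k" "0 \<le> c" "(\<integral>\<^sup>+x. ennreal (real x ^ k) \<partial>measure_pmf p) \<le> ennreal c"
  shows "(\<integral>\<^sup>+x. ennreal ((1 + real x) ^ k) \<partial>measure_pmf p) \<le> ennreal (1 + 2 ^ k * c)"
proof -
  have pointwise: "(1 + real x) ^ k \<le> 1 + 2 ^ k * real x ^ k" for x
  proof (cases "x = 0")
    case False
    then have "(1 + real x) ^ k \<le> (2 * real x) ^ k" by (intro power_mono) auto
    then show ?thesis by (simp add: power_mult_distrib)
  qed auto
  have "(\<integral>\<^sup>+x. ennreal ((1 + real x) ^ k) \<partial>measure_pmf p)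
      \<le> (\<integral>\<^sup>+x. 1 + ennreal (2 ^ k) * ennreal (real x ^ k) \<partial>measure_pmf p)"
  proof (rule nn_integral_mono)
    fix x
    have "1 + ennreal (2 ^ k) * ennreal (real x ^ k) = ennreal (1 + 2 ^ k * real x ^ k)"
      by (simp add: ennreal_plus ennreal_mult)
    then show "ennreal ((1 + real x) ^ k) \<le> 1 + ennreal (2 ^ k) * ennreal (real x ^ k)"
      using pointwise[of x] by (simp add: ennreal_leI del: ennreal_plus)
  qed
  also have "\<dots> = 1 + ennreal (2 ^ k) * (\<integral>\<^sup>+x. ennreal (real x ^ k) \<partial>measure_pmf p)"
    by (simp add: nn_integral_add nn_integral_cmult)
  also have "\<dots> \<le> 1 + ennreal (2 ^ k) * ennreal c"
    by (intro add_left_mono mult_left_mono assms) auto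
  also have "\<dots> = ennreal (1 + 2 ^ k * c)"
    using assms by (simp add: ennreal_plus ennreal_mult)
  finally show ?thesis .
qed

text \<open>Independence turns the pointwise bound \<open>1 + x + y \<le> (1 + x) (1 + y)\<close> into
  submultiplicativity.\<close>

lemma shifted_moment_add_pmf_le:
  "(\<integral>\<^sup>+x. ennreal ((1 + real x) ^ k) \<partial>measure_pmf (add_pmf p r))
    \<le> (\<integral>\<^sup>+x. ennreal ((1 + real x) ^ k) \<partial>measure_pmf p) * (\<integral>\<^sup>+x. ennreal ((1 + real x) ^ k) \<partial>measure_pmf r)"
proof -
  have pointwise: "(1 + (real x + real y)) ^ k \<le> (1 + real x) ^ k * (1 + real y) ^ k" for x y
    unfolding power_mult_distrib[symmetric] by (intro power_mono) (auto simp: algebra_simps)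
  have "(\<integral>\<^sup>+x. ennreal ((1 + real x) ^ k) \<partial>measure_pmf (add_pmf p r))
      = (\<integral>\<^sup>+x. \<integral>\<^sup>+y. ennreal ((1 + (real x + real y)) ^ k) \<partial>measure_pmf r \<partial>measure_pmf p)"
    by (simp add: add_pmf_def nn_integral_pair_pmf' case_prod_unfold)
  also have "\<dots> \<le> (\<integral>\<^sup>+x. \<integral>\<^sup>+y. ennreal ((1 + real x) ^ k) * ennreal ((1 + real y) ^ k) \<partial>measure_pmf r \<partial>measure_pmf p)"
    using pointwise by (intro nn_integral_mono) (simp add: ennreal_mult[symmetric] ennreal_leI)
  also have "\<dots> = (\<integral>\<^sup>+x. ennreal ((1 + real x) ^ k) \<partial>measure_pmf p) * (\<integral>\<^sup>+x. ennreal ((1 + real x) ^ k) \<partial>measure_pmf r)"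
    by (simp add: nn_integral_cmult nn_integral_multc)
  finally show ?thesis .
qed

lemma shifted_moment_sum_pmf_le:
  assumes "finite I" "\<And>i. i \<in> I \<Longrightarrow> 0 \<le> c i"
    and "\<And>i. i \<in> I \<Longrightarrow> (\<integral>\<^sup>+x. ennreal ((1 + real x) ^ k) \<partial>measure_pmf (p i)) \<le> ennreal (1 + c i)"
  shows "(\<integral>\<^sup>+x. ennreal ((1 + real x) ^ k) \<partial>measure_pmf (sum_pmf I p)) \<le> ennreal (exp (\<Sum>i\<in>I. c i))"
  using assms
proof induction
  case empty
  show ?case by (simp add: sum_pmf_empty)
next
  case (insert i I)
  have "(\<integral>\<^sup>+x. ennreal ((1 + real x) ^ k) \<partial>measure_pmf (sum_pmf (insert i I) p))
     \<le> ennreal (1 + c i) * ennreal (exp (\<Sum>i\<in>I. c i))"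
    using insert unfolding sum_pmf_insert[OF insert.hyps]
    by (intro order.trans[OF shifted_moment_add_pmf_le] mult_mono) auto
  also have "\<dots> \<le> ennreal (exp (c i)) * ennreal (exp (\<Sum>i\<in>I. c i))"
    by (intro mult_right_mono ennreal_leI exp_ge_add_one_self) auto
  also have "\<dots> = ennreal (exp (\<Sum>i\<in>insert i I. c i))"
    using insert.hyps by (simp add: ennreal_mult[symmetric] exp_add)
  finally show ?case .
qed

text \<open>Beyond \<open>K\<close> the function \<open>x ^ k\<close> is at most \<open>x ^ Suc k / K\<close>.\<close>

lemma truncated_moment:
  fixes s :: "nat pmf"
  assumes B: "(\<integral>\<^sup>+x. ennreal (real x ^ Suc k) \<partial>measure_pmf s) \<le> ennreal B" "0 \<le> B" and K: "0 < K"
  shows "\<bar>measure_pmf.expectation s (\<lambda>x. real x ^ k) - (\<Sum>x\<le>K. real x ^ k * pmf s x)\<bar> \<le> B / K"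
proof -
  have int1: "integrable (measure_pmf s) (\<lambda>x. real x ^ Suc k)"
    using le_less_trans[OF B(1) ennreal_less_top] by (intro integrableI_nonneg) (simp_all del: power_Suc)
  have pow: "real x ^ k \<le> 1 + real x ^ Suc k" for x :: nat
  proof (cases "x = 0")
    case False
    then have "1 * real x ^ k \<le> real x * real x ^ k" by (intro mult_right_mono) auto
    then show ?thesis by simp
  qed (auto simp: power_0_left)
  have int0: "integrable (measure_pmf s) (\<lambda>x. real x ^ k)"
  proof (rule Bochner_Integration.integrable_bound[of _ "\<lambda>x. 1 + real x ^ Suc k"])
    show "integrable (measure_pmf s) (\<lambda>x. 1 + real x ^ Suc k)"
      using int1 by (intro Bochner_Integration.integrable_add) auto
    have "norm (real x ^ k) \<le> norm (1 + real x ^ Suc k)" for x :: nat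
      using pow[of x] by (simp only: real_norm_def abs_of_nonneg zero_le_power of_nat_0_le_iff
        add_nonneg_nonneg zero_le_one)
    then show "AE x in measure_pmf s. norm (real x ^ k) \<le> norm (1 + real x ^ Suc k)"
      by (intro AE_pmfI)
  qed simp
  have intI: "integrable (measure_pmf s) (\<lambda>x. real x ^ k * indicator {..K} x)"
    by (rule integrable_real_mult_indicator[OF _ int0]) simp
  have "(\<Sum>x\<le>K. real x ^ k * pmf s x) = measure_pmf.expectation s (\<lambda>x. real x ^ k * indicator {..K} x)"
    by (subst integral_measure_pmf[of "{..K}"]) (auto simp: indicator_def mult_ac intro!: sum.cong)
  then have "measure_pmf.expectation s (\<lambda>x. real x ^ k) - (\<Sum>x\<le>K. real x ^ k * pmf s x)
      = measure_pmf.expectation s (\<lambda>x. real x ^ k - real x ^ k * indicator {..K} x)"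
    using int0 intI by simp
  moreover have "\<bar>\<dots>\<bar> \<le> measure_pmf.expectation s (\<lambda>x. \<bar>real x ^ k - real x ^ k * indicator {..K} x\<bar>)"
    by (rule integral_abs_bound)
  moreover have "\<dots> \<le> measure_pmf.expectation s (\<lambda>x. real x ^ Suc k / K)"
  proof (rule integral_mono)
    fix x
    show "\<bar>real x ^ k - real x ^ k * indicator {..K} x\<bar> \<le> real x ^ Suc k / K"
    proof (cases "x \<le> K")
      case False
      then have "real x ^ k * K \<le> real x ^ k * real x" by (intro mult_left_mono) auto
      with False K show ?thesis by (simp add: field_simps)
    qed auto
  qed (use int0 int1 intI in auto)
  moreover have "measure_pmf.expectation s (\<lambda>x. real x ^ Suc k / K) \<le> B / K"
  proof -
    have "measure_pmf.expectation s (\<lambda>x. real x ^ Suc k) \<le> B"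
      using B nn_integral_eq_integral[OF int1] by (simp del: power_Suc)
    then have "measure_pmf.expectation s (\<lambda>x. real x ^ Suc k) / K \<le> B / K"
      by (intro divide_right_mono) auto
    then show ?thesis by (simp only: integral_divide_zero)
  qed
  ultimately show ?thesis by linarith
qed

text \<open>Truncate at a level \<open>K\<close> where the tails are uniformly small; what remains is a finite
  combination of point probabilities.\<close>

lemma moments_converge:
  fixes p :: "nat \<Rightarrow> nat pmf"
  assumes conv: "\<And>x. (\<lambda>n. pmf (p n) x) \<longlonglongrightarrow> pmf r x"
    and p: "\<forall>\<^sub>F n in sequentially. (\<integral>\<^sup>+x. ennreal (real x ^ Suc k) \<partial>measure_pmf (p n)) \<le> ennreal B"
    and r: "(\<integral>\<^sup>+x. ennreal (real x ^ Suc k) \<partial>measure_pmf r) \<le> ennreal B" and "0 \<le> B"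
  shows "(\<lambda>n. measure_pmf.expectation (p n) (\<lambda>x. real x ^ k)) \<longlonglongrightarrow> measure_pmf.expectation r (\<lambda>x. real x ^ k)"
proof (rule tendstoI)
  fix e :: real assume e: "0 < e"
  obtain K where K: "3 * B / e < real K" "0 < K"
    by (metis reals_Archimedean2 gr0I not_less_zero of_nat_less_0_iff less_le_not_le
        divide_nonneg_pos e \<open>0 \<le> B\<close> mult_nonneg_nonneg of_nat_0 zero_le_numeral)
  then have small: "B / K < e / 3" using e by (simp add: field_simps)
  let ?T = "\<lambda>s. \<Sum>x\<le>K. real x ^ k * pmf s x"
  have "(\<lambda>n. ?T (p n)) \<longlonglongrightarrow> ?T r" by (intro tendsto_intros conv)
  then have "\<forall>\<^sub>F n in sequentially. dist (?T (p n)) (?T r) < e / 3"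
    using e by (intro tendstoD) auto
  with p show "\<forall>\<^sub>F n in sequentially. dist (measure_pmf.expectation (p n) (\<lambda>x. real x ^ k))
     (measure_pmf.expectation r (\<lambda>x. real x ^ k)) < e"
  proof eventually_elim
    case (elim n)
    then show ?case
      using truncated_moment[OF elim(1) \<open>0 \<le> B\<close> K(2)] truncated_moment[OF r \<open>0 \<le> B\<close> K(2)] small
      unfolding dist_real_def by linarith
  qed
qed

section \<open>The law of an array is determined by its means\<close>

lemma law_measure_pmf: "law (measure_pmf p) X = measure_pmf (map_pmf X p)"
  by (simp add: law_def map_pmf_rep_eq)

text \<open>A finite product of countable discrete spaces is discrete, so every function on it is
  measurable.\<close>

lemma measurable_map_restrict:
  fixes X :: "'i \<Rightarrow> 'a \<Rightarrow> nat" and g :: "('i \<Rightarrow> nat) \<Rightarrow> nat"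
  assumes "finite I" and X: "\<And>i. i \<in> I \<Longrightarrow> X i \<in> measurable M (count_space UNIV)"
  shows "g \<in> measurable (\<Pi>\<^sub>M i\<in>I. count_space UNIV) (count_space UNIV)"
    and "(\<lambda>\<omega>. g (\<lambda>i\<in>I. X i \<omega>)) \<in> measurable M (count_space UNIV)"
proof -
  have "(\<Pi>\<^sub>M i\<in>I. count_space UNIV :: nat measure) = count_space (PiE I (\<lambda>_. UNIV))"
    using assms by (intro count_space_PiM_finite) auto
  then show g: "g \<in> measurable (\<Pi>\<^sub>M i\<in>I. count_space UNIV) (count_space UNIV)"
    by simp
  have "(\<lambda>\<omega>. \<lambda>i\<in>I. X i \<omega>) \<in> measurable M (\<Pi>\<^sub>M i\<in>I. count_space UNIV)"
    by (intro measurable_restrict X)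
  from measurable_compose[OF this g]
  show "(\<lambda>\<omega>. g (\<lambda>i\<in>I. X i \<omega>)) \<in> measurable M (count_space UNIV)" .
qed

text \<open>Independence makes the joint law the product of the marginal laws, so any function of the
  family has a law that depends on the marginals only.\<close>

lemma law_map_indep_vars_cong:
  fixes X :: "'i \<Rightarrow> 'a \<Rightarrow> nat" and X' :: "'i \<Rightarrow> 'b \<Rightarrow> nat" and g :: "('i \<Rightarrow> nat) \<Rightarrow> nat"
  assumes M: "prob_space M" and M': "prob_space M'"
    and I: "finite I" "I \<noteq> {}"
    and X: "prob_space.indep_vars M (\<lambda>_. count_space UNIV) X I"
    and X': "prob_space.indep_vars M' (\<lambda>_. count_space UNIV) X' I"
    and law_eq: "\<And>i. i \<in> I \<Longrightarrow> law M (X i) = law M' (X' i)"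
  shows "law M (\<lambda>\<omega>. g (\<lambda>i\<in>I. X i \<omega>)) = law M' (\<lambda>\<omega>. g (\<lambda>i\<in>I. X' i \<omega>))"
proof -
  let ?P = "\<Pi>\<^sub>M i\<in>I. count_space UNIV :: nat measure"
  interpret M: prob_space M by fact
  interpret M': prob_space M' by fact
  have rv: "M.random_variable (count_space UNIV) (X i)" if "i \<in> I" for i
    using X that by (auto simp: M.indep_vars_def)
  have rv': "M'.random_variable (count_space UNIV) (X' i)" if "i \<in> I" for i
    using X' that by (auto simp: M'.indep_vars_def)
  have g: "g \<in> measurable ?P (count_space UNIV)"
    using I(1) rv by (rule measurable_map_restrict)
  have R: "(\<lambda>\<omega>. \<lambda>i\<in>I. X i \<omega>) \<in> measurable M ?P" "(\<lambda>\<omega>. \<lambda>i\<in>I. X' i \<omega>) \<in> measurable M' ?P"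
    by (auto intro!: measurable_restrict rv rv')
  have "distr M ?P (\<lambda>\<omega>. \<lambda>i\<in>I. X i \<omega>) = (\<Pi>\<^sub>M i\<in>I. distr M (count_space UNIV) (X i))"
    using M.indep_vars_iff_distr_eq_PiM'[where I = I and M' = "\<lambda>_. count_space UNIV" and X = X, OF I(2) rv] X by simp
  also have "\<dots> = (\<Pi>\<^sub>M i\<in>I. distr M' (count_space UNIV) (X' i))"
    using law_eq by (intro PiM_cong) (auto simp: law_def)
  also have "\<dots> = distr M' ?P (\<lambda>\<omega>. \<lambda>i\<in>I. X' i \<omega>)"
    using M'.indep_vars_iff_distr_eq_PiM'[where I = I and M' = "\<lambda>_. count_space UNIV" and X = X', OF I(2) rv'] X' by simp
  finally have "distr (distr M ?P (\<lambda>\<omega>. \<lambda>i\<in>I. X i \<omega>)) (count_space UNIV) g =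
      distr (distr M' ?P (\<lambda>\<omega>. \<lambda>i\<in>I. X' i \<omega>)) (count_space UNIV) g"
    by simp
  then show ?thesis
    unfolding law_def by (simp add: distr_distr[OF g R(1)] distr_distr[OF g R(2)] o_def)
qed

text \<open>The product law is nested because the sample type is curried, and because one row of products
  then becomes an independent family by \<open>Pi_pmf_map\<close>. Joint independence of all entries is easier to
  see in the uncurried form below.\<close>

definition grid_pmf :: "nat \<Rightarrow> nat \<Rightarrow> (nat \<Rightarrow> nat \<Rightarrow> nat pmf) \<Rightarrow> (nat \<Rightarrow> nat \<Rightarrow> nat) pmf" where
  "grid_pmf m q p = Pi_pmf {1..m} (\<lambda>_. 0) (\<lambda>i. Pi_pmf {1..q} 0 (p i))"

lemma grid_pmf_altdef:
  "grid_pmf m q p = map_pmf curry (Pi_pmf ({1..m} \<times> {1..q}) 0 (case_prod p))"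
proof (rule pmf_eqI)
  fix f :: "nat \<Rightarrow> nat \<Rightarrow> nat"
  have inj: "inj (curry :: (nat \<times> nat \<Rightarrow> nat) \<Rightarrow> _)"
    by (auto intro!: injI simp: fun_eq_iff curry_def)
  have "pmf (map_pmf curry (Pi_pmf ({1..m} \<times> {1..q}) 0 (case_prod p))) f
      = pmf (Pi_pmf ({1..m} \<times> {1..q}) 0 (case_prod p)) (case_prod f)"
    using pmf_map_inj'[OF inj, of _ "case_prod f"] by simp
  also have "\<dots> = (if \<forall>i j. (i, j) \<notin> {1..m} \<times> {1..q} \<longrightarrow> f i j = 0
      then \<Prod>i=1..m. \<Prod>j=1..q. pmf (p i j) (f i j) else 0)"
    by (subst pmf_Pi) (auto simp: prod.cartesian_product case_prod_unfold)
  also have "\<dots> = pmf (grid_pmf m q p) f"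
  proof (cases "\<forall>i j. (i, j) \<notin> {1..m} \<times> {1..q} \<longrightarrow> f i j = 0")
    case True
    then have "\<forall>i. i \<notin> {1..m} \<longrightarrow> f i = (\<lambda>_. 0)" by auto
    with True show ?thesis
      by (auto simp: grid_pmf_def pmf_Pi intro!: prod.cong)
  next
    case False
    then obtain i j where ij: "(i, j) \<notin> {1..m} \<times> {1..q}" "f i j \<noteq> 0" by auto
    have "pmf (grid_pmf m q p) f = 0"
    proof (cases "i \<in> {1..m}")
      case True
      then have "j \<notin> {1..q}" using ij by auto
      then have "pmf (Pi_pmf {1..q} 0 (p i)) (f i) = 0"
        using ij by (intro pmf_Pi_outside) auto
      with True show ?thesis unfolding grid_pmf_def
        by (subst pmf_Pi) (auto simp del: atLeastAtMost_iff)
    next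
      case False
      then show ?thesis unfolding grid_pmf_def
        using ij by (intro pmf_Pi_outside) (auto simp: fun_eq_iff)
    qed
    with False show ?thesis by auto
  qed
  finally show "pmf (grid_pmf m q p) f = pmf (map_pmf curry (Pi_pmf ({1..m} \<times> {1..q}) 0 (case_prod p))) f" ..
qed

lemma indep_vars_map_pmf:
  fixes X :: "'i \<Rightarrow> 'b \<Rightarrow> 'c"
  assumes "I \<noteq> {}"
    and "prob_space.indep_vars (measure_pmf p) (\<lambda>_. count_space UNIV) (\<lambda>i x. X i (h x)) I"
  shows "prob_space.indep_vars (measure_pmf (map_pmf h p)) (\<lambda>_. count_space UNIV) X I"
proof -
  let ?P = "\<Pi>\<^sub>M i\<in>I. count_space UNIV :: 'c measure"
  have R: "(\<lambda>x. \<lambda>i\<in>I. X i x) \<in> measurable (count_space UNIV) ?P"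
    by (simp add: space_PiM)
  have "distr (map_pmf h p) ?P (\<lambda>x. \<lambda>i\<in>I. X i x) = distr p ?P (\<lambda>x. \<lambda>i\<in>I. X i (h x))"
    unfolding map_pmf_rep_eq by (subst distr_distr[OF R]) (auto simp: o_def)
  also have "\<dots> = (\<Pi>\<^sub>M i\<in>I. distr p (count_space UNIV) (\<lambda>x. X i (h x)))"
    using prob_space.indep_vars_iff_distr_eq_PiM'[OF measure_pmf.prob_space_axioms assms(1),
      where M' = "\<lambda>_. count_space UNIV" and X = "\<lambda>i x. X i (h x)"] assms(2) by simp
  also have "\<dots> = (\<Pi>\<^sub>M i\<in>I. distr (map_pmf h p) (count_space UNIV) (X i))"
    unfolding map_pmf_rep_eq by (intro PiM_cong refl) (subst distr_distr, auto simp: o_def)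
  finally show ?thesis
    using prob_space.indep_vars_iff_distr_eq_PiM'[OF measure_pmf.prob_space_axioms assms(1),
      where M' = "\<lambda>_. count_space UNIV" and X = X] by simp
qed

lemma indep_vars_grid_pmf:
  assumes "1 \<le> m" "1 \<le> q"
  shows "prob_space.indep_vars (measure_pmf (grid_pmf m q p)) (\<lambda>_. count_space UNIV)
    (\<lambda>(i, j) f. f i j) ({1..m} \<times> {1..q})"
  unfolding grid_pmf_altdef
proof (rule indep_vars_map_pmf)
  show "{1..m} \<times> {1..q} \<noteq> {}" using assms by auto
  have "prob_space.indep_vars (measure_pmf (Pi_pmf ({1..m} \<times> {1..q}) 0 (case_prod p)))
     (\<lambda>_. count_space UNIV) (\<lambda>x f. f x) ({1..m} \<times> {1..q})"
    by (intro indep_vars_Pi_pmf) auto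
  then show "prob_space.indep_vars (measure_pmf (Pi_pmf ({1..m} \<times> {1..q}) 0 (case_prod p)))
     (\<lambda>_. count_space UNIV) (\<lambda>i x. (case i of (i, j) \<Rightarrow> \<lambda>f. f i j) (curry x)) ({1..m} \<times> {1..q})"
    by (simp add: case_prod_unfold)
qed

lemma law_grid_pmf:
  assumes "i \<in> {1..m}" "j \<in> {1..q}"
  shows "law (measure_pmf (grid_pmf m q p)) (\<lambda>f. f i j) = measure_pmf (p i j)"
proof -
  have "map_pmf (\<lambda>f. f i j) (grid_pmf m q p) = map_pmf (\<lambda>f. f j) (map_pmf (\<lambda>f. f i) (grid_pmf m q p))"
    by (simp add: pmf.map_comp o_def)
  also have "\<dots> = p i j"
    using assms by (simp add: grid_pmf_def Pi_pmf_component)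
  finally show ?thesis by (simp add: law_measure_pmf)
qed

lemma map_grid_pmf:
  assumes "1 \<le> q"
  shows "map_pmf (\<lambda>f. \<Sum>i=1..m. \<Prod>j=1..q. f i j) (grid_pmf m q (\<lambda>i j. poisson_law (a i j)))
    = sum_pmf {1..m} (\<lambda>i. poisson_product_pmf {1..q} (a i))"
  unfolding sum_pmf_def poisson_product_pmf_def grid_pmf_def
  using assms by (subst Pi_pmf_map[where dflt = "\<lambda>_. 0"]) (auto simp: pmf.map_comp o_def)

lemma law_sum_of_products:
  fixes N :: "nat \<Rightarrow> nat \<Rightarrow> nat \<Rightarrow> 'a \<Rightarrow> nat"
  assumes "poisson_array q m \<alpha> M N" "1 \<le> q"
  shows "law (M n) (sum_of_products q m N n)
    = measure_pmf (sum_pmf {1..m n} (\<lambda>i. poisson_product_pmf {1..q} (\<alpha> n i)))"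
proof -
  let ?G = "grid_pmf (m n) q (\<lambda>i j. poisson_law (\<alpha> n i j))"
  let ?I = "{1..m n} \<times> {1..q}"
  let ?g = "\<lambda>x. \<Sum>i=1..m n. \<Prod>j=1..q. x (i, j) :: nat"
  have m: "1 \<le> m n" and M: "prob_space (M n)"
    and ind: "prob_space.indep_vars (M n) (\<lambda>_. count_space UNIV) (\<lambda>(i, j). N n i j) ?I"
    and law: "\<And>i j. (i, j) \<in> ?I \<Longrightarrow> law (M n) (N n i j) = measure_pmf (poisson_law (\<alpha> n i j))"
    using assms(1) by (auto simp: poisson_array_def)
  have "law (M n) (\<lambda>\<omega>. ?g (\<lambda>x\<in>?I. (case x of (i, j) \<Rightarrow> N n i j) \<omega>))
      = law (measure_pmf ?G) (\<lambda>\<omega>. ?g (\<lambda>x\<in>?I. (case x of (i, j) \<Rightarrow> \<lambda>f. f i j) \<omega>))"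
    using m assms(2) law law_grid_pmf
    by (intro law_map_indep_vars_cong M ind indep_vars_grid_pmf measure_pmf.prob_space_axioms)
       (auto simp del: atLeastAtMost_iff)
  also have "(\<lambda>\<omega>. ?g (\<lambda>x\<in>?I. (case x of (i, j) \<Rightarrow> N n i j) \<omega>)) = sum_of_products q m N n"
    by (auto simp: sum_of_products_def fun_eq_iff intro!: sum.cong prod.cong)
  also have "(\<lambda>\<omega>. ?g (\<lambda>x\<in>?I. (case x of (i, j) \<Rightarrow> \<lambda>f. f i j) \<omega>))
      = (\<lambda>f. \<Sum>i=1..m n. \<Prod>j=1..q. f i j)"
    by (auto simp: fun_eq_iff intro!: sum.cong prod.cong)
  finally show ?thesis
    using assms(2) by (simp only: law_measure_pmf map_grid_pmf)
qed

lemma measurable_sum_of_products: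
  assumes "poisson_array q m \<alpha> M N"
  shows "sum_of_products q m N n \<in> measurable (M n) (count_space UNIV)"
proof -
  let ?I = "{1..m n} \<times> {1..q}"
  have M: "prob_space (M n)"
    and ind: "prob_space.indep_vars (M n) (\<lambda>_. count_space UNIV) (\<lambda>(i, j). N n i j) ?I"
    using assms by (auto simp: poisson_array_def)
  have rv: "(case x of (i, j) \<Rightarrow> N n i j) \<in> measurable (M n) (count_space UNIV)" if "x \<in> ?I" for x
    using ind that unfolding prob_space.indep_vars_def[OF M] by auto
  have "(\<lambda>\<omega>. (\<lambda>x. \<Sum>i=1..m n. \<Prod>j=1..q. x (i, j)) (\<lambda>x\<in>?I. (case x of (i, j) \<Rightarrow> N n i j) \<omega>))
    \<in> measurable (M n) (count_space UNIV)"
    by (rule measurable_map_restrict(2)[OF _ rv]) simp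
  also have "(\<lambda>\<omega>. (\<lambda>x. \<Sum>i=1..m n. \<Prod>j=1..q. x (i, j)) (\<lambda>x\<in>?I. (case x of (i, j) \<Rightarrow> N n i j) \<omega>))
      = sum_of_products q m N n"
    by (auto simp: sum_of_products_def fun_eq_iff intro!: sum.cong prod.cong)
  finally show ?thesis .
qed

lemma poisson_array_grid_pmf:
  assumes "poisson_array q m \<alpha> M N" "1 \<le> q"
  shows "poisson_array q m \<alpha> (\<lambda>n. measure_pmf (grid_pmf (m n) q (\<lambda>i j. poisson_law (\<alpha> n i j))))
     (\<lambda>n i j f. f i j)"
  using assms law_grid_pmf indep_vars_grid_pmf[OF _ assms(2)]
  by (auto simp: poisson_array_def measure_pmf.prob_space_axioms simp del: atLeastAtMost_iff)

section \<open>Convergence and rate\<close>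

lemma poisson_array_entry_bounds:
  assumes "poisson_array q m \<alpha> M N" "i \<in> {1..m n}" "j \<in> {1..q}"
  shows "0 \<le> \<alpha> n i j" "\<alpha> n i j \<le> max_mean q m \<alpha> n"
proof -
  show "0 \<le> \<alpha> n i j" using assms by (auto simp: poisson_array_def)
  have "(\<lambda>(i, j). \<alpha> n i j) (i, j) \<in> (\<lambda>(i, j). \<alpha> n i j) ` ({1..m n} \<times> {1..q})"
    using assms by (intro imageI) auto
  then show "\<alpha> n i j \<le> max_mean q m \<alpha> n"
    unfolding max_mean_def by (intro Max_ge) auto
qed

lemma poisson_array_nonneg:
  assumes "poisson_array q m \<alpha> M N" "1 \<le> q"
  shows "0 \<le> max_mean q m \<alpha> n" "0 \<le> sum_beta q m \<alpha> n"
proof -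
  have "1 \<in> {1..m n}" "1 \<in> {1..q}" using assms by (auto simp: poisson_array_def)
  from poisson_array_entry_bounds[OF assms(1) this] show "0 \<le> max_mean q m \<alpha> n" by linarith
  show "0 \<le> sum_beta q m \<alpha> n"
    unfolding sum_beta_def
    by (intro sum_nonneg prod_nonneg) (use poisson_array_entry_bounds[OF assms(1)] in auto)
qed

lemma tv_dist_sum_of_products_le:
  assumes arr: "poisson_array q m \<alpha> M N" and q: "1 \<le> q" and lam: "0 < lam"
    and small: "max_mean q m \<alpha> n \<le> 1"
  shows "tv_dist (law (M n) (sum_of_products q m N n)) (measure_pmf (poisson_pmf lam))
    \<le> real q * max_mean q m \<alpha> n * sum_beta q m \<alpha> n + \<bar>sum_beta q m \<alpha> n - lam\<bar>"
proof -
  note bounds = poisson_array_entry_bounds[OF arr]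
  define b where "b i = (\<Prod>j=1..q. \<alpha> n i j)" for i
  let ?d = "max_mean q m \<alpha> n"
  have b: "0 \<le> b i" if "i \<in> {1..m n}" for i
    unfolding b_def using bounds(1)[OF that] by (intro prod_nonneg) auto
  have S: "sum_beta q m \<alpha> n = (\<Sum>i=1..m n. b i)"
    by (simp add: sum_beta_def b_def)
  let ?P = "sum_pmf {1..m n} (\<lambda>i. poisson_product_pmf {1..q} (\<alpha> n i))"
  have "tv_dist ?P (sum_pmf {1..m n} (\<lambda>i. poisson_law (b i)))
     \<le> (\<Sum>i=1..m n. tv_dist (poisson_product_pmf {1..q} (\<alpha> n i)) (poisson_law (b i)))"
    by (rule tv_dist_sum_pmf_le) simp
  also have "\<dots> \<le> (\<Sum>i=1..m n. real (card {1..q}) * ?d * b i)"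
    unfolding b_def
  proof (rule sum_mono, rule tv_dist_poisson_product_pmf_poisson_law)
    fix i j assume "i \<in> {1..m n}" "j \<in> {1..q}"
    then show "0 \<le> \<alpha> n i j \<and> \<alpha> n i j \<le> ?d" using bounds by blast
  qed (use q small in auto)
  also have "\<dots> = real q * ?d * sum_beta q m \<alpha> n"
    by (simp add: S sum_distrib_left)
  also have "sum_pmf {1..m n} (\<lambda>i. poisson_law (b i)) = poisson_law (sum_beta q m \<alpha> n)"
    unfolding S using b by (intro sum_pmf_poisson_law) auto
  finally have "tv_dist ?P (poisson_law (sum_beta q m \<alpha> n)) \<le> real q * ?d * sum_beta q m \<alpha> n" .
  moreover have "tv_dist (poisson_law (sum_beta q m \<alpha> n)) (poisson_law lam) \<le> \<bar>sum_beta q m \<alpha> n - lam\<bar>"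
    using poisson_array_nonneg[OF arr q] lam by (intro tv_dist_poisson_law) auto
  moreover have "poisson_law lam = poisson_pmf lam"
    using lam by (simp add: poisson_law_def)
  ultimately show ?thesis
    using tv_dist_pmf_triangle[of ?P "poisson_pmf lam" "poisson_law (sum_beta q m \<alpha> n)"]
      law_sum_of_products[OF arr q, of n] by simp
qed

lemma expectation_sum_of_products:
  fixes h :: "nat \<Rightarrow> real"
  assumes "poisson_array q m \<alpha> M N" "1 \<le> q"
  shows "prob_space.expectation (M n) (\<lambda>\<omega>. h (sum_of_products q m N n \<omega>))
    = measure_pmf.expectation (sum_pmf {1..m n} (\<lambda>i. poisson_product_pmf {1..q} (\<alpha> n i))) h"
  unfolding law_sum_of_products[OF assms, symmetric] law_def
  by (rule integral_distr[symmetric]) (auto intro: measurable_sum_of_products[OF assms(1)])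

text \<open>The bound \<open>D ^ q\<close> times \<open>\<beta>\<close> on the moments of one product enters the exponent, so only the sum
  of the \<open>\<beta>\<close> over the row matters and not its length.\<close>

lemma moment_sum_of_products_bounded:
  assumes arr: "poisson_array q m \<alpha> M N" and q: "1 \<le> q" and k: "1 \<le> k"
    and d: "max_mean q m \<alpha> \<longlonglongrightarrow> 0" and S: "sum_beta q m \<alpha> \<longlonglongrightarrow> lam"
  obtains B where "0 \<le> B" "\<forall>\<^sub>F n in sequentially.
    (\<integral>\<^sup>+x. ennreal (real x ^ k) \<partial>measure_pmf (sum_pmf {1..m n} (\<lambda>i. poisson_product_pmf {1..q} (\<alpha> n i)))) \<le> ennreal B"
proof -
  obtain D where D: "0 \<le> D"
    "\<And>a. 0 \<le> a \<Longrightarrow> a \<le> 1 \<Longrightarrow>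
      (\<integral>\<^sup>+x. ennreal (real x ^ k) \<partial>measure_pmf (poisson_law a)) \<le> ennreal (D * a)"
    using poisson_law_moment_le[OF k, of 1] by auto
  have "\<forall>\<^sub>F n in sequentially. max_mean q m \<alpha> n < 1" using order_tendstoD(2)[OF d] by simp
  moreover have "\<forall>\<^sub>F n in sequentially. sum_beta q m \<alpha> n < lam + 1" using order_tendstoD(2)[OF S] by simp
  ultimately have "\<forall>\<^sub>F n in sequentially.
    (\<integral>\<^sup>+x. ennreal (real x ^ k) \<partial>measure_pmf (sum_pmf {1..m n} (\<lambda>i. poisson_product_pmf {1..q} (\<alpha> n i))))
      \<le> ennreal (exp (2 ^ k * D ^ q * (lam + 1)))"
  proof eventually_elim
    case (elim n)
    note bounds = poisson_array_entry_bounds[OF arr, of _ n]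
    have le1: "0 \<le> \<alpha> n i j \<and> \<alpha> n i j \<le> 1" if "i \<in> {1..m n}" "j \<in> {1..q}" for i j
      using bounds[OF that] elim(1) by linarith
    \<comment> \<open>\<open>2 ^ k\<close> is the cost of the shift, \<open>D\<close> that of each Poisson factor.\<close>
    let ?c = "\<lambda>i. 2 ^ k * (D ^ card {1..q} * (\<Prod>j=1..q. \<alpha> n i j))"
    have nonneg: "0 \<le> D ^ card {1..q} * (\<Prod>j=1..q. \<alpha> n i j)" if "i \<in> {1..m n}" for i
      using D(1) le1[OF that] by (intro mult_nonneg_nonneg prod_nonneg) auto
    have "(\<integral>\<^sup>+x. ennreal (real x ^ k) \<partial>measure_pmf (sum_pmf {1..m n} (\<lambda>i. poisson_product_pmf {1..q} (\<alpha> n i))))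
       \<le> (\<integral>\<^sup>+x. ennreal ((1 + real x) ^ k) \<partial>measure_pmf (sum_pmf {1..m n} (\<lambda>i. poisson_product_pmf {1..q} (\<alpha> n i))))"
      by (intro nn_integral_mono ennreal_leI power_mono) auto
    also have "\<dots> \<le> ennreal (exp (\<Sum>i=1..m n. ?c i))"
    proof (rule shifted_moment_sum_pmf_le)
      fix i assume i: "i \<in> {1..m n}"
      show "0 \<le> ?c i" using nonneg[OF i] by simp
      show "(\<integral>\<^sup>+x. ennreal ((1 + real x) ^ k) \<partial>measure_pmf (poisson_product_pmf {1..q} (\<alpha> n i))) \<le> ennreal (1 + ?c i)"
        using D le1[OF i] by (intro shifted_moment_le k nonneg i poisson_product_pmf_moment_le) auto
    qed simp
    also have "(\<Sum>i=1..m n. ?c i) = 2 ^ k * D ^ q * sum_beta q m \<alpha> n"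
      by (simp add: sum_beta_def sum_distrib_left mult_ac)
    also have "ennreal (exp \<dots>) \<le> ennreal (exp (2 ^ k * D ^ q * (lam + 1)))"
      using elim(2) D(1) by (intro ennreal_leI) (auto intro!: mult_left_mono)
    finally show ?case .
  qed
  then show ?thesis by (rule that[rotated]) simp
qed

lemma sum_of_products_tv_tendsto:
  assumes arr: "poisson_array q m \<alpha> M N" and q: "1 \<le> q" and lam: "0 < lam"
    and d: "max_mean q m \<alpha> \<longlonglongrightarrow> 0" and S: "sum_beta q m \<alpha> \<longlonglongrightarrow> lam"
  shows "(\<lambda>n. tv_dist (law (M n) (sum_of_products q m N n)) (measure_pmf (poisson_pmf lam))) \<longlonglongrightarrow> 0"
proof (rule tendsto_sandwich[OF _ _ tendsto_const])
  show "\<forall>\<^sub>F n in sequentially. 0 \<le> tv_dist (law (M n) (sum_of_products q m N n)) (measure_pmf (poisson_pmf lam))"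
    unfolding law_sum_of_products[OF arr q] by (simp add: tv_dist_pmf_nonneg)
  have "\<forall>\<^sub>F n in sequentially. max_mean q m \<alpha> n < 1" using order_tendstoD(2)[OF d] by simp
  then show "\<forall>\<^sub>F n in sequentially. tv_dist (law (M n) (sum_of_products q m N n)) (measure_pmf (poisson_pmf lam))
     \<le> real q * max_mean q m \<alpha> n * sum_beta q m \<alpha> n + \<bar>sum_beta q m \<alpha> n - lam\<bar>"
    by eventually_elim (intro tv_dist_sum_of_products_le[OF arr q lam], simp)
  show "(\<lambda>n. real q * max_mean q m \<alpha> n * sum_beta q m \<alpha> n + \<bar>sum_beta q m \<alpha> n - lam\<bar>) \<longlonglongrightarrow> 0"
    by (rule tendsto_eq_intros d S refl | simp)+
qed

lemma sum_of_products_moments_tendsto: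
  assumes arr: "poisson_array q m \<alpha> M N" and q: "1 \<le> q" and lam: "0 < lam"
    and d: "max_mean q m \<alpha> \<longlonglongrightarrow> 0" and S: "sum_beta q m \<alpha> \<longlonglongrightarrow> lam"
  shows "(\<lambda>n. prob_space.expectation (M n) (\<lambda>\<omega>. real (sum_of_products q m N n \<omega>) ^ k))
    \<longlonglongrightarrow> measure_pmf.expectation (poisson_pmf lam) (\<lambda>x. real x ^ k)"
proof -
  let ?P = "\<lambda>n. sum_pmf {1..m n} (\<lambda>i. poisson_product_pmf {1..q} (\<alpha> n i))"
  obtain B where B: "0 \<le> B" "\<forall>\<^sub>F n in sequentially.
    (\<integral>\<^sup>+x. ennreal (real x ^ Suc k) \<partial>measure_pmf (?P n)) \<le> ennreal B"
    using moment_sum_of_products_bounded[OF arr q _ d S, of "Suc k"] by auto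
  obtain D where D: "0 \<le> D"
    "\<And>a. 0 \<le> a \<Longrightarrow> a \<le> lam \<Longrightarrow>
      (\<integral>\<^sup>+x. ennreal (real x ^ Suc k) \<partial>measure_pmf (poisson_law a)) \<le> ennreal (D * a)"
    using poisson_law_moment_le[OF _ lam, of "Suc k"] by auto
  have "(\<lambda>n. measure_pmf.expectation (?P n) (\<lambda>x. real x ^ k))
    \<longlonglongrightarrow> measure_pmf.expectation (poisson_law lam) (\<lambda>x. real x ^ k)"
  proof (rule moments_converge)
    fix x
    have tv: "(\<lambda>n. tv_dist (?P n) (poisson_law lam)) \<longlonglongrightarrow> 0"
      using sum_of_products_tv_tendsto[OF assms] lam
      by (simp add: law_sum_of_products[OF arr q] poisson_law_def)
    have "(\<lambda>n. pmf (?P n) x - pmf (poisson_law lam) x) \<longlonglongrightarrow> 0"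
      by (rule Lim_null_comparison[OF always_eventually tv])
         (use tv_dist_pmf_upper[of _ "{x}"] in \<open>auto simp: measure_pmf_single\<close>)
    then show "(\<lambda>n. pmf (?P n) x) \<longlonglongrightarrow> pmf (poisson_law lam) x"
      by (rule LIM_zero_cancel)
    show "\<forall>\<^sub>F n in sequentially. (\<integral>\<^sup>+x. ennreal (real x ^ Suc k) \<partial>measure_pmf (?P n)) \<le> ennreal (max B (D * lam))"
      using B(2) by eventually_elim (erule order.trans, simp add: ennreal_leI)
    show "(\<integral>\<^sup>+x. ennreal (real x ^ Suc k) \<partial>measure_pmf (poisson_law lam)) \<le> ennreal (max B (D * lam))"
      using lam by (intro order.trans[OF D(2)] ennreal_leI) auto
  qed (use B in simp)
  then show ?thesis
    unfolding expectation_sum_of_products[OF arr q, where h = "\<lambda>x. real x ^ k"]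
    using lam by (simp add: poisson_law_def)
qed

lemma rate_constant_sum_of_products:
  assumes q: "1 \<le> q" and lam: "0 < lam"
  shows "rate_constant TYPE('a) q lam (1 + real q * (lam + 1))"
  unfolding rate_constant_def
proof (intro allI impI, elim conjE)
  fix m \<alpha> and M :: "nat \<Rightarrow> 'a measure" and N
  assume arr: "poisson_array q m \<alpha> M N" and d: "max_mean q m \<alpha> \<longlonglongrightarrow> 0" and S: "sum_beta q m \<alpha> \<longlonglongrightarrow> lam"
  have "\<forall>\<^sub>F n in sequentially. max_mean q m \<alpha> n < 1" using order_tendstoD(2)[OF d] by simp
  moreover have "\<forall>\<^sub>F n in sequentially. sum_beta q m \<alpha> n < lam + 1" using order_tendstoD(2)[OF S] by simp
  ultimately show "\<forall>\<^sub>F n in sequentially.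
       tv_dist (law (M n) (sum_of_products q m N n)) (measure_pmf (poisson_pmf lam))
         \<le> (1 + real q * (lam + 1)) * (\<bar>sum_beta q m \<alpha> n - lam\<bar> + sqrt (max_mean q m \<alpha> n))"
  proof eventually_elim
    case (elim n)
    define \<delta> where "\<delta> = max_mean q m \<alpha> n"
    define s where "s = sum_beta q m \<alpha> n"
    have \<delta>: "0 \<le> \<delta>" "\<delta> < 1" and s: "0 \<le> s" "s < lam + 1"
      using elim poisson_array_nonneg[OF arr q] by (auto simp: \<delta>_def s_def)
    have sqrt: "\<delta> \<le> sqrt \<delta>"
      using \<delta> by (intro real_le_rsqrt) (simp add: power2_eq_square mult_left_le)
    have "tv_dist (law (M n) (sum_of_products q m N n)) (measure_pmf (poisson_pmf lam))
       \<le> real q * \<delta> * s + \<bar>s - lam\<bar>"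
      using tv_dist_sum_of_products_le[OF arr q lam, of n] \<delta> by (simp add: \<delta>_def s_def)
    also have "real q * \<delta> * s \<le> real q * sqrt \<delta> * (lam + 1)"
      using \<delta> s sqrt by (intro mult_mono) auto
    also have "real q * sqrt \<delta> * (lam + 1) + \<bar>s - lam\<bar>
        \<le> (1 + real q * (lam + 1)) * (\<bar>s - lam\<bar> + sqrt \<delta>)"
    proof -
      have "0 \<le> real q * (lam + 1) * \<bar>s - lam\<bar>" "0 \<le> sqrt \<delta>"
        using lam \<delta> by auto
      then show ?thesis by (simp add: algebra_simps)
    qed
    finally show ?case by (simp add: \<delta>_def s_def)
  qed
qed

text \<open>The array of coordinate functions on the grid has the same means, hence both sides of the
  inequality are unchanged.\<close>

lemma rate_constant_transfer:
  assumes C: "rate_constant TYPE(nat \<Rightarrow> nat \<Rightarrow> nat) q lam C" and q: "1 \<le> q"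
  shows "rate_constant TYPE('a) q lam C"
  unfolding rate_constant_def
proof (intro allI impI, elim conjE)
  fix m \<alpha> and M :: "nat \<Rightarrow> 'a measure" and N
  assume arr: "poisson_array q m \<alpha> M N" and lim: "max_mean q m \<alpha> \<longlonglongrightarrow> 0" "sum_beta q m \<alpha> \<longlonglongrightarrow> lam"
  note arr' = poisson_array_grid_pmf[OF arr q]
  from arr' lim have "\<forall>\<^sub>F n in sequentially.
       tv_dist (law (measure_pmf (grid_pmf (m n) q (\<lambda>i j. poisson_law (\<alpha> n i j))))
          (sum_of_products q m (\<lambda>n i j f. f i j) n)) (measure_pmf (poisson_pmf lam))
         \<le> C * (\<bar>sum_beta q m \<alpha> n - lam\<bar> + sqrt (max_mean q m \<alpha> n))"
    using C unfolding rate_constant_def by blast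
  then show "\<forall>\<^sub>F n in sequentially.
       tv_dist (law (M n) (sum_of_products q m N n)) (measure_pmf (poisson_pmf lam))
         \<le> C * (\<bar>sum_beta q m \<alpha> n - lam\<bar> + sqrt (max_mean q m \<alpha> n))"
    unfolding law_sum_of_products[OF arr q] law_sum_of_products[OF arr' q] .
qed

theorem corollary1p9:
  fixes q :: nat and lam :: real
  assumes "2 \<le> q" and "0 < lam"
  shows "(\<forall>m \<alpha> (M :: nat \<Rightarrow> 'a measure) N.
            poisson_array q m \<alpha> M N \<and> max_mean q m \<alpha> \<longlonglongrightarrow> 0 \<and> sum_beta q m \<alpha> \<longlonglongrightarrow> lam \<longrightarrow>
            (\<lambda>n. tv_dist (law (M n) (sum_of_products q m N n)) (measure_pmf (poisson_pmf lam)))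
              \<longlonglongrightarrow> 0 \<and>
            (\<forall>k\<in>{1..4::nat}.
               (\<lambda>n. prob_space.expectation (M n) (\<lambda>\<omega>. real (sum_of_products q m N n \<omega>) ^ k))
                 \<longlonglongrightarrow> measure_pmf.expectation (poisson_pmf lam) (\<lambda>x. real x ^ k)))
       \<and> (\<exists>C. rate_constant TYPE(nat \<Rightarrow> nat \<Rightarrow> nat) q lam C)
       \<and> (\<forall>C. rate_constant TYPE(nat \<Rightarrow> nat \<Rightarrow> nat) q lam C \<longrightarrow> rate_constant TYPE('a) q lam C)"
proof -
  have q: "1 \<le> q" using assms(1) by simp
  show ?thesis
    using sum_of_products_tv_tendsto[OF _ q assms(2)] sum_of_products_moments_tendsto[OF _ q assms(2)]
      rate_constant_sum_of_products[OF q assms(2)] rate_constant_transfer[OF _ q]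
    by blast
qed

end
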